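(* Let $A \subset S^n$ be a finite subset which is generic in the sense that, for all $k<n$, no set of $k+3$ points in $A$ is contained in a $k$-sphere (of any radius). Let $p\le n$ and let $\sigma = [a_0 a_1 \ldots a_p]$ be a simplex with vertices in $A$. Then $\sigma$ has a strong witness in $S^n$ with respect to $A$ if and only if every subsimplex $\tau \leq \sigma$ has a weak witness in $S^n$ with respect to $A$.
   Context: $S^n\subset\mathbb{R}^{n+1}$ is the unit sphere with its intrinsic geodesic metric $d(x,y)=\arccos\langle x,y\rangle$. For $0\le k<n$, a $k$-sphere (of any radius) in $S^n$ is a $k$-dimensional round sphere (great or small), i.e. the intersection of $S^n$ with a $(k+1)$-dimensional affine subspace of $\mathbb{R}^{n+1}$ meeting $S^n$ in more than one point. A simplex $\sigma=[a_0\ldots a_p]$ with vertices in $A$ is a set of $p+1$ distinct points $\{a_0,\ldots,a_p\}\subseteq A$; a subsimplex $\tau\le\sigma$ is a simplex whose vertex set is a nonempty subset of that of $\sigma$ (including $\sigma$ itself). A point $x\in S^n$ is a weak witness for $\sigma$ with respect to $A$ if $d(x,a)\le d(x,b)$ whenever $a\in\{a_0,\ldots,a_p\}$ and $b\in A\setminus\{a_0,\ldots,a_p\}$. It is a strong witness for $\sigma$ with respect to $A$ if it is a weak witness and additionally $d(x,a_0)=d(x,a_1)=\cdots=d(x,a_p)$. *)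

theory Defs
  imports "HOL-Analysis.Analysis"
begin

text \<open>
  Euclidean space of dimension n + 1 is a type of class \<^class>\<open>euclidean_space\<close> with DIM = n + 1;
  its n-sphere is \<^term>\<open>sphere 0 1\<close>. The formula below is the geodesic distance only between
  unit vectors.
\<close>

definition geodesic_dist :: "'a::euclidean_space \<Rightarrow> 'a \<Rightarrow> real" where
  "geodesic_dist x y = arccos (x \<bullet> y)"

definition round_subsphere :: "nat \<Rightarrow> 'a::euclidean_space set \<Rightarrow> bool" where
  "round_subsphere k S \<longleftrightarrow>
     (\<exists>V. affine V \<and> aff_dim V = int k + 1 \<and> S = sphere 0 1 \<inter> V) \<and>
     (\<exists>x\<in>S. \<exists>y\<in>S. x \<noteq> y)"

definition generic_on_sphere :: "nat \<Rightarrow> 'a::euclidean_space set \<Rightarrow> bool" where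
  "generic_on_sphere n A \<longleftrightarrow>
     (\<forall>k<n. \<forall>B\<subseteq>A. card B = k + 3 \<longrightarrow> \<not> (\<exists>S. round_subsphere k S \<and> B \<subseteq> S))"

text \<open>
  A simplex is its set of vertices; unlike in \<^const>\<open>simplex\<close>, no convex hull is taken.
\<close>

definition vertex_simplex :: "nat \<Rightarrow> 'a set \<Rightarrow> 'a set \<Rightarrow> bool" where
  "vertex_simplex p A \<sigma> \<longleftrightarrow> \<sigma> \<subseteq> A \<and> finite \<sigma> \<and> card \<sigma> = p + 1"

definition subsimplex :: "'a set \<Rightarrow> 'a set \<Rightarrow> bool" where
  "subsimplex \<tau> \<sigma> \<longleftrightarrow> \<tau> \<noteq> {} \<and> \<tau> \<subseteq> \<sigma>"

definition weak_witness :: "'a::euclidean_space set \<Rightarrow> 'a set \<Rightarrow> 'a \<Rightarrow> bool" where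
  "weak_witness A \<sigma> x \<longleftrightarrow>
     x \<in> sphere 0 1 \<and> (\<forall>a\<in>\<sigma>. \<forall>b\<in>A - \<sigma>. geodesic_dist x a \<le> geodesic_dist x b)"

definition strong_witness :: "'a::euclidean_space set \<Rightarrow> 'a set \<Rightarrow> 'a \<Rightarrow> bool" where
  "strong_witness A \<sigma> x \<longleftrightarrow>
     weak_witness A \<sigma> x \<and> (\<forall>a\<in>\<sigma>. \<forall>a'\<in>\<sigma>. geodesic_dist x a = geodesic_dist x a')"

end

theory Submission
  imports Defs
begin

text \<open>
  On the sphere the witness conditions are linear inequalities in \<open>x\<close>. The only
  solution that must be excluded is \<open>x = 0\<close>. If a strong witness does not exist, separation shows that every vector has
  the form \<open>\<Sum>a. c a *\<^sub>R a\<close> with \<open>\<Sum>a. c a = 0\<close> and \<open>c \<le> 0\<close> off \<open>\<sigma>\<close>; this yields an affine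
  dependence whose positive part \<open>\<tau>\<close> is a nonempty subset of \<open>\<sigma>\<close>. A weak witness \<open>x\<close> for \<open>\<tau>\<close>
  separates the positive from the negative part, so \<open>y \<mapsto> x \<bullet> y\<close> is constant on the support. By
  genericity, any \<open>n + 2\<close> points of \<open>A\<close> are affinely independent, so the support, being dependent,
  has at least \<open>n + 3\<close> points, and no hyperplane contains it.
\<close>

lemma geodesic_dist_le_iff:
  fixes x a b :: "'a::euclidean_space"
  assumes "x \<in> sphere 0 1" "a \<in> sphere 0 1" "b \<in> sphere 0 1"
  shows "geodesic_dist x a \<le> geodesic_dist x b \<longleftrightarrow> x \<bullet> b \<le> x \<bullet> a"
proof -
  have "\<bar>x \<bullet> a\<bar> \<le> 1" "\<bar>x \<bullet> b\<bar> \<le> 1"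
    using assms Cauchy_Schwarz_ineq2[of x a] Cauchy_Schwarz_ineq2[of x b] by auto
  then show ?thesis
    unfolding geodesic_dist_def by (rule arccos_le_mono)
qed

lemma weak_witness_iff:
  fixes A :: "'a::euclidean_space set"
  assumes "A \<subseteq> sphere 0 1" "\<sigma> \<subseteq> A"
  shows "weak_witness A \<sigma> x \<longleftrightarrow> x \<in> sphere 0 1 \<and> (\<forall>a\<in>\<sigma>. \<forall>b\<in>A - \<sigma>. x \<bullet> b \<le> x \<bullet> a)"
  unfolding weak_witness_def
  using assms geodesic_dist_le_iff by (metis DiffD1 subsetD)

text \<open>A vertex of \<open>\<sigma>\<close> left out of \<open>\<tau>\<close> is exactly as far
  from \<open>x\<close> as those kept, so passing to \<open>\<tau>\<close> adds only
  equalities.\<close>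

lemma strong_witness_imp_weak_witness_subset:
  assumes "strong_witness A \<sigma> x" "\<tau> \<subseteq> \<sigma>"
  shows "weak_witness A \<tau> x"
  using assms unfolding strong_witness_def weak_witness_def
  by (metis DiffD1 DiffD2 DiffI order_refl subsetD)

text \<open>Add points one at a time. A point that first creates a dependence lies in the affine
  hull of the earlier, independent ones, and that hull cuts the unit sphere in a round sphere
  holding one point too many for genericity.\<close>

lemma generic_on_sphere_affine_independent:
  fixes A B :: "'a::euclidean_space set"
  assumes "generic_on_sphere n A" "A \<subseteq> sphere 0 1"
    and "B \<subseteq> A" "finite B" "card B \<le> n + 2"
  shows "\<not> affine_dependent B"
  using assms(4,3,5)
proof (induction B rule: finite_induct)
  case empty
  then show ?case by simp
next
  case (insert b B)
  then have indep: "\<not> affine_dependent B" by simp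
  show ?case
  proof (cases "card B \<le> 1")
    case True
    then consider "B = {}" | c where "B = {c}"
      using insert.hyps by (metis One_nat_def card_0_eq card_1_singletonE le_SucE le_zero_eq)
    then show ?thesis
      by cases (auto simp: affine_independent_2)
  next
    case False
    \<comment> \<open>At least two points are present, so the subtraction does not truncate;
      \<open>card (insert b B) \<le> n + 2\<close> becomes \<open>k < n\<close>.\<close>
    define k where "k = card B - 2"
    have k: "k < n" "card (insert b B) = k + 3" "card B = k + 2"
      using False insert by (auto simp: k_def)
    show ?thesis
    proof
      assume dep: "affine_dependent (insert b B)"
      let ?V = "affine hull (insert b B)"
      have "b \<in> affine hull B"
        using dep affine_independent_insert[OF indep] by blast
      then have "aff_dim ?V = aff_dim B"
        by (simp add: hull_redundant)
      also have "\<dots> = int k + 1"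
        using aff_dim_affine_independent[OF indep] k by simp
      finally have dim: "aff_dim ?V = int k + 1" .
      have sub: "insert b B \<subseteq> sphere 0 1 \<inter> ?V"
        using insert.prems assms(2) by (auto simp: hull_inc)
      obtain c where "c \<in> B"
        using k by fastforce
      then have "\<exists>x\<in>sphere 0 1 \<inter> ?V. \<exists>y\<in>sphere 0 1 \<inter> ?V. x \<noteq> y"
        using sub insert.hyps by (metis insertCI subsetD)
      then have "round_subsphere k (sphere 0 1 \<inter> ?V)"
        unfolding round_subsphere_def using dim affine_affine_hull by blast
      then show False
        using assms(1) sub k insert.prems unfolding generic_on_sphere_def by blast
    qed
  qed
qed

text \<open>Farkas-type alternative, stated with \<open>x \<noteq> 0\<close>: the cone of combinations need not be shown to
  be closed, since a proper convex cone always lies in a closed half-space.\<close>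

lemma strong_witness_or_affine_dependence:
  fixes A \<sigma> :: "'a::euclidean_space set"
  assumes "finite A" "\<sigma> \<subseteq> A" "a\<^sub>0 \<in> \<sigma>" "b\<^sub>0 \<in> A - \<sigma>"
  obtains (witness) x where "x \<noteq> 0" "\<And>a a'. a \<in> \<sigma> \<Longrightarrow> a' \<in> \<sigma> \<Longrightarrow> x \<bullet> a = x \<bullet> a'"
      "\<And>a b. a \<in> \<sigma> \<Longrightarrow> b \<in> A - \<sigma> \<Longrightarrow> x \<bullet> b \<le> x \<bullet> a"
  | (dependence) c where "sum c A = 0" "(\<Sum>a\<in>A. c a *\<^sub>R a) = 0" "c b\<^sub>0 < 0"
      "\<And>b. b \<in> A - \<sigma> \<Longrightarrow> c b \<le> 0"
proof -
  define P where "P c \<longleftrightarrow> sum c A = 0 \<and> (\<forall>b\<in>A - \<sigma>. c b \<le> 0)" for c :: "'a \<Rightarrow> real"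
  define L where "L c = (\<Sum>a\<in>A. c a *\<^sub>R a)" for c :: "'a \<Rightarrow> real"
  \<comment> \<open>The coefficients that represent the difference \<open>a - b\<close>.\<close>
  define e where "e a b x = of_bool (x = a) - (of_bool (x = b) :: real)" for a b x :: 'a
  have sum_e: "sum (e a b) A = 0" and L_e: "L (e a b) = a - b" if "a \<in> A" "b \<in> A" for a b
    using that assms(1)
    by (simp_all add: e_def L_def sum_subtractf scaleR_diff_left of_bool_def if_distrib[of "\<lambda>r. r *\<^sub>R _"] sum.delta cong: if_cong)
  \<comment> \<open>A convex cone containing \<open>a - b\<close> for all
    \<open>a \<in> \<sigma>\<close> and \<open>b \<in> A\<close>; a vector nonnegative on it is the
    desired \<open>x\<close>.\<close>
  define D where "D = L ` Collect P"
  have P_combine: "P (\<lambda>a. u * c a + v * d a)" if "P c" "P d" "u \<ge> 0" "v \<ge> 0" for c d u v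
    using that unfolding P_def
    by (auto simp: sum.distrib simp flip: sum_distrib_left
        intro!: add_nonpos_nonpos mult_nonneg_nonpos)
  have L_combine: "L (\<lambda>a. u * c a + v * d a) = u *\<^sub>R L c + v *\<^sub>R L d" for c d u v
    unfolding L_def by (simp add: scaleR_add_left sum.distrib scaleR_sum_right)
  have D_combine: "u *\<^sub>R y + v *\<^sub>R z \<in> D" if yz: "y \<in> D" "z \<in> D" and uv: "u \<ge> 0" "v \<ge> 0" for y z u v
  proof -
    obtain c d where "P c" "P d" "y = L c" "z = L d"
      using yz unfolding D_def by auto
    then have "P (\<lambda>a. u * c a + v * d a)" "u *\<^sub>R y + v *\<^sub>R z = L (\<lambda>a. u * c a + v * d a)"
      using P_combine uv L_combine by simp_all
    then show ?thesis
      unfolding D_def by (intro image_eqI[of _ L "\<lambda>a. u * c a + v * d a"]) simp_all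
  qed
  have D_e: "a - b \<in> D" if "a \<in> \<sigma>" "b \<in> A" for a b
  proof -
    have "P (e a b)"
      using that sum_e assms(2) unfolding P_def e_def by auto
    moreover have "L (e a b) = a - b"
      using L_e that assms(2) by blast
    ultimately show ?thesis
      unfolding D_def by (intro image_eqI[of _ L "e a b"]) simp_all
  qed
  show thesis
  proof (cases "D = UNIV")
    case True
    \<comment> \<open>Adding \<open>e a\<^sub>0 b\<^sub>0\<close> to coefficients of
      \<open>b\<^sub>0 - a\<^sub>0\<close> cancels the vector and lowers the coefficient at
      \<open>b\<^sub>0\<close> by 1, which makes it strictly negative.\<close>
    then have "b\<^sub>0 - a\<^sub>0 \<in> L ` Collect P"
      unfolding D_def by simp
    then obtain c where c: "P c" "L c = b\<^sub>0 - a\<^sub>0"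
      by (elim imageE) simp
    have ab: "a\<^sub>0 \<in> A" "b\<^sub>0 \<in> A" "a\<^sub>0 \<noteq> b\<^sub>0"
      using assms(2-4) by blast+
    have nonpos: "c b \<le> 0" if "b \<in> A - \<sigma>" for b
      using c(1) that unfolding P_def by blast
    show thesis
    proof (rule dependence[of "\<lambda>a. c a + e a\<^sub>0 b\<^sub>0 a"])
      show "(\<Sum>a\<in>A. (c a + e a\<^sub>0 b\<^sub>0 a) *\<^sub>R a) = 0"
        using L_combine[of 1 c 1 "e a\<^sub>0 b\<^sub>0"] L_e ab c unfolding L_def by simp
      show "c b + e a\<^sub>0 b\<^sub>0 b \<le> 0" if "b \<in> A - \<sigma>" for b
        using nonpos[OF that] that assms(3) by (auto simp: e_def)
      show "(\<Sum>a\<in>A. c a + e a\<^sub>0 b\<^sub>0 a) = 0"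
        using c sum_e ab unfolding P_def by (simp add: sum.distrib)
      show "c b\<^sub>0 + e a\<^sub>0 b\<^sub>0 b\<^sub>0 < 0"
        using nonpos[OF assms(4)] ab by (simp add: e_def)
    qed
  next
    case False
    then obtain z where z: "z \<notin> D" by auto
    have "convex D"
      unfolding convex_def using D_combine by blast
    moreover have "0 \<in> D"
      using D_e[OF assms(3)] assms(2,3) by (metis cancel_comm_monoid_add_class.diff_cancel subsetD)
    ultimately obtain x t where "x \<noteq> 0" and xz: "x \<bullet> z \<le> t" and xD: "\<And>d. d \<in> D \<Longrightarrow> t \<le> x \<bullet> d"
      using separating_hyperplane_sets[of "{z}" D] z by auto
    have nonneg: "0 \<le> x \<bullet> d" if "d \<in> D" for d
    proof (rule ccontr)
      assume neg: "\<not> 0 \<le> x \<bullet> d"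
      \<comment> \<open>Scaling within the cone: this factor takes the inner product down to
        \<open>- (\<bar>t\<bar> + 1)\<close>, below the bound \<open>t\<close>.\<close>
      define s where "s = (\<bar>t\<bar> + 1) / - (x \<bullet> d)"
      have "s *\<^sub>R d \<in> D"
        using D_combine[OF that that, of s 0] neg by (simp add: s_def divide_nonneg_neg)
      then have "t \<le> s * (x \<bullet> d)"
        using xD by fastforce
      also have "\<dots> = - (\<bar>t\<bar> + 1)"
        using neg by (simp add: s_def)
      finally show False by linarith
    qed
    \<comment> \<open>Here \<open>b\<close> may itself lie in \<open>\<sigma>\<close>; exchanging
      two vertices then yields equality.\<close>
    have ineq: "x \<bullet> b \<le> x \<bullet> a" if "a \<in> \<sigma>" "b \<in> A" for a b
      using nonneg[OF D_e[OF that]] by (simp add: inner_diff_right)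
    show thesis
    proof (rule witness[OF \<open>x \<noteq> 0\<close>])
      show "x \<bullet> a = x \<bullet> a'" if "a \<in> \<sigma>" "a' \<in> \<sigma>" for a a'
        using ineq that assms(2) by (meson order_antisym subsetD)
    qed (use ineq in auto)
  qed
qed

text \<open>With \<open>t\<close> the least value of \<open>x \<bullet> a\<close> where
  \<open>c a > 0\<close>, all terms \<open>c a * (x \<bullet> a - t)\<close> are nonnegative. They
  sum to 0 by the two relations on \<open>c\<close>, so each vanishes.\<close>

lemma inner_constant_on_support:
  fixes x :: "'a::real_inner"
  assumes "finite A" "sum c A = 0" "(\<Sum>a\<in>A. c a *\<^sub>R a) = 0"
    and sep: "\<And>a b. a \<in> A \<Longrightarrow> b \<in> A \<Longrightarrow> c a > 0 \<Longrightarrow> c b \<le> 0 \<Longrightarrow> x \<bullet> b \<le> x \<bullet> a"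
    and ex: "a\<^sub>1 \<in> A" "c a\<^sub>1 > 0"
  obtains t where "\<And>a. a \<in> A \<Longrightarrow> c a \<noteq> 0 \<Longrightarrow> x \<bullet> a = t"
proof -
  define T where "T = {a \<in> A. c a > 0}"
  define t where "t = Min ((\<bullet>) x ` T)"
  have T: "finite T" "T \<noteq> {}"
    using assms(1) ex unfolding T_def by auto
  have t_le: "t \<le> x \<bullet> a" if "a \<in> T" for a
    using that T unfolding t_def by simp
  have "t \<in> (\<bullet>) x ` T"
    unfolding t_def using T by (intro Min_in) auto
  then obtain a\<^sub>2 where a2: "a\<^sub>2 \<in> T" "t = x \<bullet> a\<^sub>2" by auto
  have nonneg: "0 \<le> c a * (x \<bullet> a - t)" if "a \<in> A" for a
  proof (cases "c a > 0")
    case True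
    then show ?thesis using t_le that unfolding T_def by simp
  next
    case False
    then have "x \<bullet> a \<le> t"
      using sep[of a\<^sub>2 a] a2 that unfolding T_def by simp
    then show ?thesis
      using False by (intro mult_nonpos_nonpos) auto
  qed
  have "(\<Sum>a\<in>A. c a * (x \<bullet> a - t)) = x \<bullet> (\<Sum>a\<in>A. c a *\<^sub>R a) - sum c A * t"
    by (simp add: right_diff_distrib sum_subtractf inner_sum_right sum_distrib_right)
  also have "\<dots> = 0"
    using assms by simp
  finally have "\<forall>a\<in>A. c a * (x \<bullet> a - t) = 0"
    using sum_nonneg_eq_0_iff[OF assms(1) nonneg] by simp
  then show thesis
    by (intro that[of t]) auto
qed

theorem theorem6:
  fixes A \<sigma> :: "'a::euclidean_space set" and n p :: nat
  assumes "DIM('a) = n + 1"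
    and "finite A" and "A \<subseteq> sphere 0 1"
    and "generic_on_sphere n A"
    and "p \<le> n" and "vertex_simplex p A \<sigma>"
  shows "(\<exists>x. strong_witness A \<sigma> x) \<longleftrightarrow>
         (\<forall>\<tau>. subsimplex \<tau> \<sigma> \<longrightarrow> (\<exists>x. weak_witness A \<tau> x))"
proof
  assume "\<exists>x. strong_witness A \<sigma> x"
  then show "\<forall>\<tau>. subsimplex \<tau> \<sigma> \<longrightarrow> (\<exists>x. weak_witness A \<tau> x)"
    using strong_witness_imp_weak_witness_subset unfolding subsimplex_def by blast
next
  assume weak: "\<forall>\<tau>. subsimplex \<tau> \<sigma> \<longrightarrow> (\<exists>x. weak_witness A \<tau> x)"
  have \<sigma>: "\<sigma> \<subseteq> A" "card \<sigma> = p + 1"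
    using assms(6) unfolding vertex_simplex_def by auto
  then obtain a\<^sub>0 where a0: "a\<^sub>0 \<in> \<sigma>"
    by fastforce
  \<comment> \<open>The linear conditions survive positive scaling, so a nonzero solution can be
    normalised to a point of the sphere.\<close>
  have strong: "\<exists>x. strong_witness A \<sigma> x"
    if x: "x \<noteq> 0" "\<And>a a'. a \<in> \<sigma> \<Longrightarrow> a' \<in> \<sigma> \<Longrightarrow> x \<bullet> a = x \<bullet> a'"
      "\<And>a b. a \<in> \<sigma> \<Longrightarrow> b \<in> A - \<sigma> \<Longrightarrow> x \<bullet> b \<le> x \<bullet> a" for x
  proof -
    have "sgn x \<in> sphere 0 1"
      using x(1) by (simp add: norm_sgn)
    moreover have sgn_inner: "sgn x \<bullet> a = (x \<bullet> a) / norm x" for a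
      by (simp add: sgn_div_norm divide_inverse mult.commute)
    ultimately have "weak_witness A \<sigma> (sgn x)"
      unfolding weak_witness_iff[OF assms(3) \<sigma>(1)] by (auto intro: divide_right_mono x(3))
    moreover have "geodesic_dist (sgn x) a = geodesic_dist (sgn x) a'" if "a \<in> \<sigma>" "a' \<in> \<sigma>" for a a'
      unfolding geodesic_dist_def sgn_inner x(2)[OF that] ..
    ultimately show ?thesis
      unfolding strong_witness_def by blast
  qed
  show "\<exists>x. strong_witness A \<sigma> x"
  proof (cases "A = \<sigma>")
    case True
    \<comment> \<open>Here \<open>p \<le> n\<close> is essential: \<open>A\<close> has too few points to span the whole space affinely.\<close>
    have "aff_dim \<sigma> < int DIM('a)"
      using aff_dim_le_card[of \<sigma>] assms(1,2,5) \<sigma> True by auto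
    then obtain x t where "x \<noteq> 0" "\<sigma> \<subseteq> {y. x \<bullet> y = t}"
      by (rule aff_lowdim_subset_hyperplane)
    then have "x \<bullet> a = t" if "a \<in> \<sigma>" for a
      using that by blast
    then show ?thesis
      using True by (intro strong[OF \<open>x \<noteq> 0\<close>]) simp_all
  next
    case False
    then obtain b\<^sub>0 where b0: "b\<^sub>0 \<in> A - \<sigma>"
      using \<sigma> by blast
    from assms(2) \<sigma>(1) a0 b0 show ?thesis
    proof (cases rule: strong_witness_or_affine_dependence)
      case (witness x)
      then show ?thesis by (rule strong)
    next
      case (dependence c)
      \<comment> \<open>The one subsimplex to which the hypothesis is applied.\<close>
      define \<tau> where "\<tau> = {a \<in> A. c a > 0}"
      define S where "S = {a \<in> A. c a \<noteq> 0}"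
      have S: "finite S" "S \<subseteq> A"
        using assms(2) unfolding S_def by auto
      \<comment> \<open>Without positive coefficients, the zero sum would force \<open>c\<close> to
        vanish on \<open>A\<close>, against \<open>c b\<^sub>0 < 0\<close>.\<close>
      have "\<tau> \<noteq> {}"
      proof
        assume "\<tau> = {}"
        then have "\<And>a. a \<in> A \<Longrightarrow> 0 \<le> - c a"
          unfolding \<tau>_def by force
        then have "\<forall>a\<in>A. - c a = 0"
          using sum_nonneg_eq_0_iff[OF assms(2), of "\<lambda>a. - c a"] dependence(1)
          by (simp add: sum_negf)
        then show False
          using dependence(3) b0 by auto
      qed
      moreover have "\<tau> \<subseteq> \<sigma>"
        using dependence(4) unfolding \<tau>_def by force
      ultimately obtain x where "weak_witness A \<tau> x"
        using weak unfolding subsimplex_def by blast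
      then have x: "norm x = 1" "\<And>a b. a \<in> \<tau> \<Longrightarrow> b \<in> A - \<tau> \<Longrightarrow> x \<bullet> b \<le> x \<bullet> a"
        using weak_witness_iff[OF assms(3), of \<tau> x] \<open>\<tau> \<subseteq> \<sigma>\<close> \<sigma>(1) by auto
      obtain a\<^sub>1 where "a\<^sub>1 \<in> A" "c a\<^sub>1 > 0"
        using \<open>\<tau> \<noteq> {}\<close> unfolding \<tau>_def by blast
      moreover have "x \<bullet> b \<le> x \<bullet> a" if "a \<in> A" "b \<in> A" "c a > 0" "c b \<le> 0" for a b
        using x(2)[of a b] that unfolding \<tau>_def by simp
      ultimately obtain t where t: "\<And>a. a \<in> A \<Longrightarrow> c a \<noteq> 0 \<Longrightarrow> x \<bullet> a = t"
        using inner_constant_on_support[OF assms(2) dependence(1,2)] by metis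
      have "sum c S = 0" "(\<Sum>a\<in>S. c a *\<^sub>R a) = 0"
        using dependence(1,2) unfolding S_def
        by (auto intro: trans[OF sum.mono_neutral_left[OF assms(2)]])
      moreover have "b\<^sub>0 \<in> S"
        using b0 dependence(3) unfolding S_def by auto
      ultimately have "affine_dependent S"
        using dependence(3)
        by (subst affine_dependent_explicit_finite[OF S(1)]) (metis less_irrefl)
      then have "n + 2 \<le> card S"
        using generic_on_sphere_affine_independent[OF assms(4,3) S(2,1)] by fastforce
      \<comment> \<open>These \<open>n + 2\<close> independent points affinely span the whole space,
        yet lie in the hyperplane where \<open>x \<bullet> y = t\<close>.\<close>
      then obtain B where B: "B \<subseteq> S" "card B = n + 2" "finite B"
        using obtain_subset_with_card_n by metis
      then have "\<not> affine_dependent B"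
        using generic_on_sphere_affine_independent[OF assms(4,3)] S(2) by auto
      then have "aff_dim B = int n + 1"
        using aff_dim_affine_independent B by fastforce
      moreover have "B \<subseteq> {y. x \<bullet> y = t}"
        using B(1) t unfolding S_def by auto
      then have "aff_dim B \<le> aff_dim {y. x \<bullet> y = t}"
        by (rule aff_dim_subset)
      moreover have "aff_dim {y. x \<bullet> y = t} = int n"
        using aff_dim_hyperplane[of x t] x(1) assms(1) by (cases "x = 0") simp_all
      ultimately show ?thesis by simp
    qed
  qed
qed

end
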